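(* Let $d=1$. Then $I=I^{BJ}$, and $\bar J=\underline J=J^{BJ}$, $\mu$-a.s.
   Context: Here $d=1$: $\Omega:=\mathbb R\times\mathbb R$ with canonical maps $X(x,y)=x$, $Y(x,y)=y$. $\mu,\nu$ are Borel probability measures on $\mathbb R$ with finite first moments and $\mu\preceq\nu$ in convex order, i.e. $\mu(f)\le\nu(f)$ for every finite convex $f$. $\mathcal M(\mu,\nu)$ is the (nonempty) set of Borel probability measures $\mathbb P$ on $\Omega$ with $\mathbb P\circ X^{-1}=\mu$, $\mathbb P\circ Y^{-1}=\nu$ and $\mathbb E^{\mathbb P}[Y|X]=X$, $\mathbb P$-a.s. A statement about $X$ (or about set-valued maps of $x$) holds $\mu$-a.s. if it holds for $\mu$-a.e. $x$. For $\mathbb P\in\mathcal M(\mu,\nu)$, $\mathbb P_x$ is the conditional kernel: $\mathbb P(dx,dy)=\mu(dx)\otimes\mathbb P_x(dy)$ (with $x\mapsto\mathbb P_x[B]$ only required measurable for the $\sigma$-algebra generated by analytic sets). $\mathrm{supp}$ is the smallest closed support, $\mathrm{csupp}:=\mathrm{cl}\,\mathrm{conv}\,\mathrm{supp}$; $\gamma|_A:=\gamma[\,\cdot\cap A]$; $\mathrm{ri}$ is the relative interior, $\partial A:=\mathrm{cl}\,A\setminus\mathrm{ri}\,A$. Fix $\widehat{\mathbb P}\in\mathcal M(\mu,\nu)$ and a version of its kernel (these exist) such that, with $I(x):=\mathrm{ri}\,\mathrm{csupp}\,\widehat{\mathbb P}_x$ and $\underline J(x):=I(x)\cup\{y:\nu[\{y\}]>0,\widehat{\mathbb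 P}_x[\{y\}]>0\}$, $\bar J(x):=I(x)\cup\mathrm{csupp}\,\widehat{\mathbb P}_x|_{\partial I(x)}$: (a) for all $\mathbb P\in\mathcal M(\mu,\nu)$, $\mathrm{csupp}\,\mathbb P_X\subset\mathrm{csupp}\,\widehat{\mathbb P}_X$ and $\mathrm{supp}\,\mathbb P_X|_{\partial I(X)}\subset\mathrm{csupp}\,\widehat{\mathbb P}_X|_{\partial I(X)}$, $\mu$-a.s., and $\mu[\mathbb P_X[\{y\}]>0]\le\mu[\widehat{\mathbb P}_X[\{y\}]>0]$ for all $y$; (b) $x\mapsto\mathrm{csupp}\,\widehat{\mathbb P}_x$ is analytically measurable, $x\in I(x)$ for all $x$ and $\{I(x)\}_x$ is a partition of $\mathbb R$; (c) $\bar J$ is convex valued, $I\subset\underline J\subset\bar J\subset\mathrm{cl}\,I$, and $\underline J,\bar J$ are constant on each $I(x)$. These maps are $\mu$-a.s. independent of the choice of $\widehat{\mathbb P}$. Beiglböck–Juillet (BJ) components. Let $u_\mu(x):=\int|x-y|\mu(dy)$, $u_\nu(x):=\int|x-y|\nu(dy)$, so $u_\mu\le u_\nu$. Let $(I_k)_{k\ge1}$ be the (at most countably many) open connected components of $\{u_\mu<u_\nu\}$. Let $\nu_k:=\int_{x\in I_k}\mathbb P(dx,\cdot)$, which does not depend on $\mathbb P\in\mathcal M(\mu,\nu)$, and let $J_k$ be the union of $I_k$ and those endpoints of $I_k$ that are atoms of $\nu_k$. Then $(I^{BJ},J^{BJ})(x):=(I_k,J_k)$ if $x\in I_k$ for some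 $k\ge1$, and $(I^{BJ},J^{BJ})(x):=(\{x\},\{x\})$ if $x\notin\bigcup_kI_k$. *)

theory Defs
  imports "HOL-Probability.Probability"
begin

section \<open>Martingale couplings\<close>

text \<open>
  The integral of a function that need not be integrable, as the difference of the integrals of
  the positive and the negative part, with values in the extended reals.
\<close>

definition ext_integral :: "'a measure \<Rightarrow> ('a \<Rightarrow> real) \<Rightarrow> ereal" where
  "ext_integral M f =
     enn2ereal (\<integral>\<^sup>+x. ennreal (f x) \<partial>M) - enn2ereal (\<integral>\<^sup>+x. ennreal (- f x) \<partial>M)"

definition convex_order :: "real measure \<Rightarrow> real measure \<Rightarrow> bool" where
  "convex_order \<mu> \<nu> \<longleftrightarrow>
     (\<forall>f :: real \<Rightarrow> real. convex_on UNIV f \<longrightarrow> ext_integral \<mu> f \<le> ext_integral \<nu> f)"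

definition martingale_couplings :: "real measure \<Rightarrow> real measure \<Rightarrow> (real \<times> real) measure set" where
  "martingale_couplings \<mu> \<nu> =
     {P. prob_space P \<and> sets P = sets borel \<and> distr P borel fst = \<mu> \<and> distr P borel snd = \<nu> \<and>
         (AE \<omega> in P. real_cond_exp P (vimage_algebra (space P) fst borel) snd \<omega> = fst \<omega>)}"


section \<open>Analytic sets and conditional kernels\<close>

text \<open>
  The type \<open>nat \<Rightarrow> nat\<close> with the product topology is the Baire space, so this says that \<open>A\<close> is empty
  or a continuous image of the Baire space.
\<close>

definition analytic_set :: "'a::topological_space set \<Rightarrow> bool" where
  "analytic_set A \<longleftrightarrow> A = {} \<or> (\<exists>f :: (nat \<Rightarrow> nat) \<Rightarrow> 'a. continuous_on UNIV f \<and> range f = A)"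

definition analytic_algebra :: "'a::topological_space measure" where
  "analytic_algebra = sigma UNIV {A. analytic_set A}"

text \<open>
  Analytic measurability of a closed-set-valued map, with respect to the Borel \<open>\<sigma>\<close>-algebra of
  the Wijsman topology on closed sets, which is generated by the families of closed sets that
  meet a given open set.
\<close>

definition analytically_measurable_setmap ::
    "('a::topological_space \<Rightarrow> 'b::topological_space set) \<Rightarrow> bool" where
  "analytically_measurable_setmap F \<longleftrightarrow>
     (\<forall>V. open V \<longrightarrow> {x. F x \<inter> V \<noteq> {}} \<in> sets analytic_algebra)"

text \<open>
  \<open>\<kappa>\<close> is a version of the conditional kernel of \<open>P\<close>, that is, \<open>P(dx,dy) = \<mu>(dx) \<kappa>\<^sub>x(dy)\<close>. Since
  \<open>\<kappa>\<close> is only analytically measurable, the integral is taken with respect to the completion of \<open>\<mu>\<close>.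
\<close>

definition cond_kernel ::
    "real measure \<Rightarrow> (real \<times> real) measure \<Rightarrow> (real \<Rightarrow> real measure) \<Rightarrow> bool" where
  "cond_kernel \<mu> P \<kappa> \<longleftrightarrow>
     (\<forall>x. prob_space (\<kappa> x) \<and> sets (\<kappa> x) = sets borel) \<and>
     (\<forall>B \<in> sets borel. (\<lambda>x. emeasure (\<kappa> x) B) \<in> borel_measurable analytic_algebra) \<and>
     (\<forall>A \<in> sets borel. \<forall>B \<in> sets borel.
        emeasure P (A \<times> B) = (\<integral>\<^sup>+x\<in>A. emeasure (\<kappa> x) B \<partial>completion \<mu>))"


section \<open>Supports and the maps \<open>I\<close>, \<open>J\<close>\<close>

definition msupp :: "'a::topological_space measure \<Rightarrow> 'a set" where
  "msupp M = \<Inter> {C. closed C \<and> emeasure M (- C) = 0}"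

definition csupp :: "real measure \<Rightarrow> real set" where
  "csupp M = closure (convex hull (msupp M))"

text \<open>
  \<open>M[\<cdot> \<inter> A]\<close> as a measure on the whole line; \<open>restrict_space\<close> would change the underlying space.
\<close>

definition mrestr :: "real measure \<Rightarrow> real set \<Rightarrow> real measure" where
  "mrestr M A = density M (indicator A)"

definition I_map :: "(real \<Rightarrow> real measure) \<Rightarrow> real \<Rightarrow> real set" where
  "I_map \<kappa> x = rel_interior (csupp (\<kappa> x))"

definition J_lower :: "real measure \<Rightarrow> (real \<Rightarrow> real measure) \<Rightarrow> real \<Rightarrow> real set" where
  "J_lower \<nu> \<kappa> x = I_map \<kappa> x \<union> {y. measure \<nu> {y} > 0 \<and> measure (\<kappa> x) {y} > 0}"

definition J_upper :: "(real \<Rightarrow> real measure) \<Rightarrow> real \<Rightarrow> real set" where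
  "J_upper \<kappa> x = I_map \<kappa> x \<union> csupp (mrestr (\<kappa> x) (rel_frontier (I_map \<kappa> x)))"


section \<open>Beiglboeck--Juillet components\<close>

definition potential :: "real measure \<Rightarrow> real \<Rightarrow> real" where
  "potential \<mu> x = (\<integral>y. \<bar>x - y\<bar> \<partial>\<mu>)"

definition BJ_domain :: "real measure \<Rightarrow> real measure \<Rightarrow> real set" where
  "BJ_domain \<mu> \<nu> = {x. potential \<mu> x < potential \<nu> x}"

definition I_BJ :: "real measure \<Rightarrow> real measure \<Rightarrow> real \<Rightarrow> real set" where
  "I_BJ \<mu> \<nu> x =
     (if x \<in> BJ_domain \<mu> \<nu> then connected_component_set (BJ_domain \<mu> \<nu>) x else {x})"

text \<open>The second marginal of the part of \<open>P\<close> lying above \<open>U\<close>.\<close>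

definition BJ_marginal :: "(real \<times> real) measure \<Rightarrow> real set \<Rightarrow> real measure" where
  "BJ_marginal P U = distr (density P (indicator (U \<times> UNIV))) borel snd"

text \<open>
  The marginals \<open>BJ_marginal P U\<close> of the components \<open>U\<close> do not depend on the choice of the martingale
  coupling \<open>P\<close>; the coupling used is kept as a parameter. As \<open>U\<close> is an open interval, its
  frontier consists of its (finite) endpoints.
\<close>

definition J_BJ :: "real measure \<Rightarrow> real measure \<Rightarrow> (real \<times> real) measure \<Rightarrow> real \<Rightarrow> real set" where
  "J_BJ \<mu> \<nu> P x =
     (if x \<in> BJ_domain \<mu> \<nu>
      then (let U = connected_component_set (BJ_domain \<mu> \<nu>) x
            in U \<union> {e \<in> frontier U. measure (BJ_marginal P U) {e} > 0})
      else {x})"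

end

theory Submission
  imports Defs
begin

text \<open>
  For a martingale coupling \<open>P\<close>, \<open>u\<^sub>\<mu>(z) = \<integral> sgn (X - z) (Y - z) dP\<close>, so \<open>u\<^sub>\<mu>(z) = u\<^sub>\<nu>(z)\<close> holds
  exactly if \<open>P\<close> transports no mass across or away from \<open>z\<close>; call such a \<open>z\<close> a contact point.

  If \<open>I(z) = {z}\<close>, then no other \<open>I(x)\<close> contains \<open>z\<close>, so no kernel measure crosses \<open>z\<close> and \<open>z\<close> is a
  contact point. Hence \<open>I(z)\<close> is an open interval for every \<open>z\<close> in a component of \<open>{u\<^sub>\<mu> < u\<^sub>\<nu>}\<close>; as the
  component is connected, a single \<open>I(x)\<close> covers it. Conversely, if an open \<open>I(x)\<close> contained a contact
  point, then almost no kernel measure over \<open>I(x)\<close> could have the support that \<open>I(x)\<close> prescribes, so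
  \<open>\<mu>(I(x)) = 0\<close>. Only countably many \<open>I(x)\<close> are open, which gives \<open>I = I\<^sup>B\<^sup>J\<close> almost surely.

  For the boundary, the constancy of the two maps \<open>J\<close> on \<open>I(x)\<close> means that an endpoint \<open>e\<close> belongs to
  \<open>J(y)\<close> for all or for no \<open>y \<in> I(x)\<close>, so integrating over \<open>I(x)\<close> compares both with the mass that
  the coupling sends from \<open>I(x)\<close> to \<open>e\<close>.
\<close>

section \<open>Lower integrals\<close>

text \<open>The integral of a nonmeasurable \<open>f\<close> is a supremum over simple functions
  below \<open>f\<close>. Countably many of them suffice for it, and their pointwise supremum
  \<open>h\<close> is measurable.\<close>

lemma nn_integral_measurable_minorant:
  obtains h where "h \<in> borel_measurable M" "h \<le> f" "integral\<^sup>N M h = integral\<^sup>N M f"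
proof -
  let ?S = "{g. simple_function M g \<and> g \<le> f}"
  have "(\<lambda>_. 0) \<in> ?S"
    by (auto simp: le_fun_def)
  then have "?S \<noteq> {}"
    by blast
  then obtain s :: "nat \<Rightarrow> ennreal" where s: "range s \<subseteq> integral\<^sup>S M ` ?S"
    and sup: "integral\<^sup>N M f = Sup (range s)"
    using ennreal_SUP_countable_SUP[of ?S "integral\<^sup>S M"] nn_integral_def[of M f] by metis
  have "\<exists>g. g \<in> ?S \<and> integral\<^sup>S M g = s n" for n
    using subsetD[OF s rangeI, of n] by fastforce
  then obtain g where g: "\<And>n. g n \<in> ?S" "\<And>n. integral\<^sup>S M (g n) = s n"
    using choice[of "\<lambda>n g. g \<in> ?S \<and> integral\<^sup>S M g = s n"] by blast
  define h where "h x = (SUP n. g n x)" for x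
  have [measurable]: "g n \<in> borel_measurable M" for n
    using g(1)[of n] by (auto intro: borel_measurable_simple_function)
  have meas: "h \<in> borel_measurable M"
    unfolding h_def by measurable
  have le: "h \<le> f"
    using g(1) by (auto simp: h_def le_fun_def intro!: SUP_least)
  have "s n \<le> integral\<^sup>N M h" for n
  proof -
    have "s n = integral\<^sup>N M (g n)"
      using g[of n] by (simp add: nn_integral_eq_simple_integral)
    also have "\<dots> \<le> integral\<^sup>N M h"
      by (intro nn_integral_mono) (auto simp: h_def intro: SUP_upper)
    finally show ?thesis .
  qed
  then have "integral\<^sup>N M f \<le> integral\<^sup>N M h"
    unfolding sup by (auto intro: SUP_least)
  moreover have "integral\<^sup>N M h \<le> integral\<^sup>N M f"
    using le by (auto intro: nn_integral_mono simp: le_fun_def)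
  ultimately show ?thesis
    using that meas le by (metis order.antisym)
qed

text \<open>Measurability of \<open>f\<close> is bypassed through a measurable minorant with the
  same integral: it stays below 1 on \<open>A\<close>, so equality of the integrals would make
  \<open>A\<close> null.\<close>

lemma nn_integral_less_emeasure:
  fixes f :: "'a \<Rightarrow> ennreal"
  assumes A: "A \<in> sets M" "emeasure M A \<noteq> 0" "emeasure M A \<noteq> \<infinity>"
    and f: "\<And>x. x \<in> A \<Longrightarrow> f x < 1"
  shows "(\<integral>\<^sup>+x\<in>A. f x \<partial>M) < emeasure M A"
proof -
  obtain h where [measurable]: "h \<in> borel_measurable M"
    and h: "h \<le> (\<lambda>x. f x * indicator A x)" "integral\<^sup>N M h = (\<integral>\<^sup>+x\<in>A. f x \<partial>M)"
    using nn_integral_measurable_minorant by blast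
  have less: "h x < 1" if "x \<in> A" for x
    using le_funD[OF h(1), of x] f[OF that] that by (auto intro: le_less_trans)
  have le: "h x \<le> indicator A x" for x
    using le_funD[OF h(1), of x] less[of x] by (auto simp: indicator_def)
  have "integral\<^sup>N M h < integral\<^sup>N M (indicator A)"
  proof (rule nn_integral_less)
    have "integral\<^sup>N M h \<le> integral\<^sup>N M (indicator A)"
      by (intro nn_integral_mono le)
    then show "integral\<^sup>N M h \<noteq> \<infinity>"
      using A by (auto simp: top_unique)
    show "\<not> (AE x in M. indicator A x \<le> h x)"
    proof
      assume "AE x in M. indicator A x \<le> h x"
      then have "AE x in M. x \<notin> A"
        by eventually_elim (use less in \<open>force simp: indicator_def\<close>)
      with A show False
        using AE_iff_null_sets[of A M] by (simp add: null_sets_def)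
    qed
  qed (use A le in auto)
  then show ?thesis
    using A h by simp
qed

section \<open>Supports and intervals\<close>

text \<open>By Lindelof, countably many null open sets already cover the complement of the
  support.\<close>

lemma emeasure_Compl_msupp:
  fixes M :: "'a::second_countable_topology measure"
  assumes "sets M = sets borel"
  shows "emeasure M (- msupp M) = 0"
proof -
  let ?F = "{U. open U \<and> emeasure M U = 0}"
  have "- msupp M = \<Union>?F"
    unfolding msupp_def
    by (auto intro: exI[of _ "- X" for X])
  moreover obtain F where F: "F \<subseteq> ?F" "countable F" "\<Union>F = \<Union>?F"
    using Lindelof[of ?F] by auto
  moreover have "(\<Union>U\<in>F. U) \<in> null_sets M"
    using F assms by (intro null_sets_UN') (auto simp: null_sets_def)
  ultimately show ?thesis
    by auto
qed

lemma msupp_subset: "closed C \<Longrightarrow> emeasure M (- C) = 0 \<Longrightarrow> msupp M \<subseteq> C"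
  by (auto simp: msupp_def)

lemma csupp_subset:
  assumes "closed C" "convex C" "emeasure M (- C) = 0"
  shows "csupp M \<subseteq> C"
  unfolding csupp_def using assms by (intro closure_minimal hull_minimal msupp_subset)

lemma closed_msupp: "closed (msupp M)"
  unfolding msupp_def by (rule closed_Inter) auto

lemma emeasure_eq_0_if_csupp_subset:
  assumes "sets M = sets borel" "csupp M \<subseteq> C"
  shows "emeasure M (- C) = 0"
proof -
  have "msupp M \<subseteq> C"
    using assms(2) unfolding csupp_def by (meson closure_subset hull_subset order_trans)
  moreover have "- msupp M \<in> sets M"
    using assms(1) closed_msupp[of M] by (simp add: borel_open open_Compl)
  ultimately have "emeasure M (- C) \<le> emeasure M (- msupp M)"
    by (intro emeasure_mono) auto
  then show ?thesis
    using emeasure_Compl_msupp[OF assms(1)] by simp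
qed

lemma convex_csupp: "convex (csupp M)"
  by (simp add: csupp_def convex_closure)

lemma closed_csupp: "closed (csupp M)"
  by (simp add: csupp_def)

text \<open>A second point puts a segment into \<open>S\<close>; then \<open>S\<close> has nonempty
  interior, which is its relative interior.\<close>

lemma rel_interior_real_cases:
  fixes S :: "real set"
  assumes "convex S" "x \<in> rel_interior S"
  obtains "S = {x}" | "open (rel_interior S)" "rel_interior S \<noteq> {x}"
proof (cases "S = {x}")
  case False
  have x: "x \<in> S"
    using assms(2) rel_interior_subset by blast
  with False obtain y where y: "y \<in> S" "y \<noteq> x"
    by blast
  then have "{min x y<..<max x y} \<subseteq> S"
    using closed_segment_subset[OF x y(1) assms(1)]
    by (auto simp: closed_segment_eq_real_ivl split: if_splits)
  then have "{min x y<..<max x y} \<subseteq> interior S"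
    by (simp add: interior_maximal)
  moreover have "{min x y<..<max x y} \<noteq> {}"
    using y by auto
  ultimately have "interior S \<noteq> {}"
    by blast
  then have "open (rel_interior S)"
    by (simp add: rel_interior_nonempty_interior)
  moreover have "\<not> open {x}"
    by (rule not_open_singleton)
  ultimately show ?thesis
    using that(2) by metis
qed

text \<open>An open interval lies on one side of each endpoint. The witness \<open>u\<close> cuts
  off the piece of \<open>U\<close> next to \<open>e\<close>; the other endpoint, if any, lies
  beyond \<open>u\<close>, so a closed half-line ending at \<open>u\<close> contains it but not
  \<open>e\<close>.\<close>

lemma frontier_real_interval:
  fixes U :: "real set"
  assumes "open U" "connected U" "U \<noteq> {}" "e \<in> frontier U"
  obtains u where "U \<subseteq> {..<e}" "u \<in> U" "u < e" "{u..<e} \<subseteq> U" "frontier U \<subseteq> insert e {..u}"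
  | u where "U \<subseteq> {e<..}" "u \<in> U" "e < u" "{e<..u} \<subseteq> U" "frontier U \<subseteq> insert e {u..}"
proof -
  obtain u where u: "u \<in> U"
    using assms(3) by blast
  have disj: "frontier U \<inter> U = {}"
    using assms(1) frontier_disjoint_eq by blast
  then have ne: "e \<notin> U"
    using assms(4) by blast
  have iv: "x \<in> U" if "a \<in> U" "b \<in> U" "a \<le> x" "x \<le> b" for a b x
    using assms(2) that connected_contains_Icc by fastforce
  have cl: "frontier U \<subseteq> closure U"
    by (simp add: frontier_def)
  have near: "\<exists>w\<in>U. \<bar>w - f\<bar> < d" if "f \<in> frontier U" "0 < d" for f d
    using cl that by (auto simp: closure_approachable dist_real_def)
  consider "u < e" | "e < u"
    using u ne by (metis linorder_less_linear)
  then show thesis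
  proof cases
    case 1
    have below: "U \<subseteq> {..<e}"
    proof
      fix x assume "x \<in> U"
      then show "x \<in> {..<e}"
        using iv[OF u, of x e] 1 ne by force
    qed
    have ivl: "{u..<e} \<subseteq> U"
    proof
      fix x assume x: "x \<in> {u..<e}"
      then obtain w where "w \<in> U" "\<bar>w - e\<bar> < e - x"
        using near[OF assms(4), of "e - x"] by auto
      then show "x \<in> U"
        using x iv[OF u, of w x] by auto
    qed
    have "frontier U \<subseteq> insert e {..u}"
    proof
      fix f assume f: "f \<in> frontier U"
      have "f \<le> e"
        using subsetD[OF cl f] closure_mono[OF below] by auto
      moreover have "f \<notin> {u..<e}"
        using f disj ivl by auto
      ultimately show "f \<in> insert e {..u}"
        by auto
    qed
    then show thesis
      using that(1) below u 1 ivl by blast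
  next
    case 2
    have above: "U \<subseteq> {e<..}"
    proof
      fix x assume "x \<in> U"
      then show "x \<in> {e<..}"
        using iv[OF _ u, of x e] 2 ne by force
    qed
    have ivl: "{e<..u} \<subseteq> U"
    proof
      fix x assume x: "x \<in> {e<..u}"
      then obtain w where "w \<in> U" "\<bar>w - e\<bar> < x - e"
        using near[OF assms(4), of "x - e"] by auto
      then show "x \<in> U"
        using x iv[OF _ u, of w x] by auto
    qed
    have "frontier U \<subseteq> insert e {u..}"
    proof
      fix f assume f: "f \<in> frontier U"
      have "e \<le> f"
        using subsetD[OF cl f] closure_mono[OF above] by auto
      moreover have "f \<notin> {e<..u}"
        using f disj ivl by auto
      ultimately show "f \<in> insert e {u..}"
        by auto
    qed
    then show thesis
      using that(2) above u 2 ivl by blast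
  qed
qed

lemma emeasure_mrestr:
  assumes "sets M = sets borel" "F \<in> sets borel" "B \<in> sets borel"
  shows "emeasure (mrestr M F) B = emeasure M (F \<inter> B)"
  unfolding mrestr_def using assms
  by (subst emeasure_density) (auto simp flip: indicator_inter_arith)

text \<open>Without mass at \<open>e\<close>, the restricted measure would live on the other
  endpoint, hence on a closed half-line missing \<open>e\<close>; this half-line would also contain
  the closed convex hull of the support.\<close>

lemma emeasure_pos_if_endpoint_in_csupp:
  fixes U :: "real set"
  assumes M: "sets M = sets borel" and U: "open U" "connected U" "U \<noteq> {}" "e \<in> frontier U"
    and e: "e \<in> csupp (mrestr M (frontier U))"
  shows "emeasure M {e} \<noteq> 0"
proof
  assume 0: "emeasure M {e} = 0"
  have *: False if C: "closed C" "convex C" "e \<notin> C" "frontier U \<subseteq> insert e C" for C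
  proof -
    have "emeasure (mrestr M (frontier U)) (- C) = emeasure M (frontier U \<inter> - C)"
      using M C by (intro emeasure_mrestr) auto
    also have "\<dots> \<le> emeasure M {e}"
      using M C by (intro emeasure_mono) auto
    finally have "csupp (mrestr M (frontier U)) \<subseteq> C"
      using 0 C by (intro csupp_subset) auto
    then show False
      using e C by auto
  qed
  from U show False
  proof (cases rule: frontier_real_interval)
    case (1 u)
    then show False
      using *[of "{..u}"] by auto
  next
    case (2 u)
    then show False
      using *[of "{u..}"] by auto
  qed
qed

section \<open>Potentials and components\<close>

lemma integrable_abs_diff:
  assumes "finite_measure M" "sets M = sets borel" "integrable M (\<lambda>x. x)"
  shows "integrable M (\<lambda>y. \<bar>x - y\<bar> :: real)"
  using assms finite_measure.integrable_const[OF assms(1), of x]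
  by (intro integrable_abs Bochner_Integration.integrable_diff) auto

text \<open>The triangle inequality makes the potential of a probability measure
  1-Lipschitz.\<close>

lemma continuous_on_potential:
  assumes "prob_space M" "sets M = sets borel" "integrable M (\<lambda>x. x)"
  shows "continuous_on UNIV (potential M)"
proof -
  interpret prob_space M by fact
  have *: "integrable M (\<lambda>y. \<bar>x - y\<bar>)" for x
    using assms finite_measure_axioms by (intro integrable_abs_diff)
  have "potential M x - potential M y \<le> \<bar>x - y\<bar>" for x y
  proof -
    have "potential M x \<le> (\<integral>t. \<bar>x - y\<bar> + \<bar>y - t\<bar> \<partial>M)"
      unfolding potential_def using * by (intro integral_mono) auto
    then show ?thesis
      using * by (simp add: potential_def prob_space)
  qed
  then have "dist (potential M x) (potential M y) \<le> 1 * dist x y" for x y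
    by (metis (no_types) abs_le_iff abs_minus_commute dist_real_def minus_diff_eq mult_1)
  then have "1-lipschitz_on UNIV (potential M)"
    by (intro lipschitz_onI) auto
  then show ?thesis
    by (rule lipschitz_on_continuous_on)
qed

lemma open_BJ_domain:
  assumes "prob_space \<mu>" "sets \<mu> = sets borel" "integrable \<mu> (\<lambda>x. x)"
    and "prob_space \<nu>" "sets \<nu> = sets borel" "integrable \<nu> (\<lambda>x. x)"
  shows "open (BJ_domain \<mu> \<nu>)"
  unfolding BJ_domain_def using assms by (intro open_Collect_less continuous_on_potential)

text \<open>The point \<open>a\<close> is the left endpoint of the component of \<open>u\<close>:
  the largest point below \<open>u\<close> of the closed set \<open>- D\<close>, where
  \<open>x\<close> ensures that such points exist. It later serves as a barrier for mass starting
  further left.\<close>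

lemma left_of_component:
  fixes D :: "real set"
  assumes "open D" "u \<in> D" "x < u" "x \<notin> connected_component_set D u"
  obtains a where "a \<notin> D" "a < u" "\<And>x. x < u \<Longrightarrow> x \<notin> connected_component_set D u \<Longrightarrow> x \<le> a"
proof -
  let ?T = "- D \<inter> {..u}"
  have *: "\<exists>c\<in>?T. x \<le> c" if "x < u" "x \<notin> connected_component_set D u" for x
  proof (rule ccontr)
    assume "\<not> (\<exists>c\<in>?T. x \<le> c)"
    then have "{x..u} \<subseteq> D"
      by auto
    then have "{x..u} \<subseteq> connected_component_set D u"
      using that by (intro connected_component_maximal) auto
    then show False
      using that by (auto dest: subsetD[of _ _ x])
  qed
  have T: "?T \<noteq> {}" "bdd_above ?T" "closed ?T"
    using *[of x] assms by (auto simp: closed_Compl)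
  then have T_mem: "Sup ?T \<in> ?T"
    by (rule closed_contains_Sup)
  show thesis
  proof
    show "Sup ?T \<notin> D"
      using T_mem by simp
    show "Sup ?T < u"
      using T_mem assms(2) by (cases "Sup ?T = u") auto
  next
    fix x assume "x < u" "x \<notin> connected_component_set D u"
    then obtain c where "c \<in> ?T" "x \<le> c"
      using * by blast
    then show "x \<le> Sup ?T"
      using T(2) cSup_upper[of c ?T] by linarith
  qed
qed

text \<open>Mirror image of \<open>left_of_component\<close>.\<close>

lemma right_of_component:
  fixes D :: "real set"
  assumes "open D" "u \<in> D" "u < x" "x \<notin> connected_component_set D u"
  obtains a where "a \<notin> D" "u < a" "\<And>x. u < x \<Longrightarrow> x \<notin> connected_component_set D u \<Longrightarrow> a \<le> x"
proof -
  let ?T = "- D \<inter> {u..}"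
  have *: "\<exists>c\<in>?T. c \<le> x" if "u < x" "x \<notin> connected_component_set D u" for x
  proof (rule ccontr)
    assume "\<not> (\<exists>c\<in>?T. c \<le> x)"
    then have "{u..x} \<subseteq> D"
      by auto
    then have "{u..x} \<subseteq> connected_component_set D u"
      using that by (intro connected_component_maximal) auto
    then show False
      using that by (auto dest: subsetD[of _ _ x])
  qed
  have T: "?T \<noteq> {}" "bdd_below ?T" "closed ?T"
    using *[of x] assms by (auto simp: closed_Compl)
  then have T_mem: "Inf ?T \<in> ?T"
    by (rule closed_contains_Inf)
  show thesis
  proof
    show "Inf ?T \<notin> D"
      using T_mem by simp
    show "u < Inf ?T"
      using T_mem assms(2) by (cases "Inf ?T = u") auto
  next
    fix x assume "u < x" "x \<notin> connected_component_set D u"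
    then obtain c where "c \<in> ?T" "c \<le> x"
      using * by blast
    then show "Inf ?T \<le> x"
      using T(2) cInf_lower[of c ?T] by linarith
  qed
qed

section \<open>Martingale couplings and contact points\<close>

text \<open>The coupling is arbitrary because these facts are applied both to \<open>Phat\<close>,
  whose kernel defines the paving, and to the \<open>P\<close> in \<open>J_BJ\<close>.\<close>

locale martingale_coupling =
  fixes \<mu> \<nu> :: "real measure" and P :: "(real \<times> real) measure"
  assumes mu: "prob_space \<mu>" "sets \<mu> = sets borel" "integrable \<mu> (\<lambda>x. x)"
    and nu: "prob_space \<nu>" "sets \<nu> = sets borel" "integrable \<nu> (\<lambda>x. x)"
    and coupling: "P \<in> martingale_couplings \<mu> \<nu>"
begin

abbreviation D where "D \<equiv> BJ_domain \<mu> \<nu>"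

lemma prob_P: "prob_space P" and sets_P [measurable_cong]: "sets P = sets borel"
  and distr_fst: "distr P borel fst = \<mu>" and distr_snd: "distr P borel snd = \<nu>"
  and cond_exp: "AE \<omega> in P. real_cond_exp P (vimage_algebra (space P) fst borel) snd \<omega> = fst \<omega>"
  using coupling by (auto simp: martingale_couplings_def)

sublocale prob_space P
  by (rule prob_P)

lemma space_P: "space P = UNIV"
  using sets_eq_imp_space_eq[OF sets_P] by simp

lemma fst_measurable [measurable]: "fst \<in> borel_measurable P"
  and snd_measurable [measurable]: "snd \<in> borel_measurable P"
  using sets_P by (simp_all add: measurable_cong_sets[OF sets_P refl] flip: borel_prod)

lemma integrable_fst [simp]: "integrable P (\<lambda>\<omega>. fst \<omega> :: real)"
  using mu(3) unfolding distr_fst[symmetric] by (simp add: integrable_distr_eq)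

lemma integrable_snd [simp]: "integrable P (\<lambda>\<omega>. snd \<omega> :: real)"
  using nu(3) unfolding distr_snd[symmetric] by (simp add: integrable_distr_eq)

lemma times_in_sets: "A \<in> sets borel \<Longrightarrow> B \<in> sets borel \<Longrightarrow> A \<times> B \<in> sets P"
  unfolding sets_P borel_prod[symmetric] by simp

section \<open>Potentials as expectations under the coupling\<close>

lemma potential_mu: "potential \<mu> z = (\<integral>\<omega>. \<bar>fst \<omega> - z\<bar> \<partial>P)"
  unfolding potential_def distr_fst[symmetric]
  by (subst integral_distr) (auto simp: abs_minus_commute)

lemma potential_nu: "potential \<nu> z = (\<integral>\<omega>. \<bar>snd \<omega> - z\<bar> \<partial>P)"
  unfolding potential_def distr_snd[symmetric]
  by (subst integral_distr) (auto simp: abs_minus_commute)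

lemma integrable_sgn:
  "integrable P (\<lambda>\<omega>. sgn (fst \<omega> - z) * (snd \<omega> - z))"
  "integrable P (\<lambda>\<omega>. sgn (fst \<omega> - z) * snd \<omega>)"
  by (rule Bochner_Integration.integrable_bound[of P "\<lambda>\<omega>. \<bar>snd \<omega> - z\<bar>"]
      Bochner_Integration.integrable_bound[of P "\<lambda>\<omega>. \<bar>snd \<omega>\<bar>"];
      auto simp: abs_mult sgn_if)+

text \<open>The sign of X - z is a bounded function of X, so the martingale property allows Y to be
  replaced by X under the integral.\<close>

lemma expectation_sgn: "(\<integral>\<omega>. sgn (fst \<omega> - z) * (snd \<omega> - z) \<partial>P) = potential \<mu> z"
proof -
  let ?F = "vimage_algebra (space P) fst borel"
  have "subalgebra P ?F"
    unfolding subalgebra_def by (auto simp: sets_vimage_algebra2 intro!: measurable_sets)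
  then interpret finite_measure_subalgebra P ?F
    by unfold_locales
  have [measurable]: "fst \<in> borel_measurable ?F"
    by (rule measurable_vimage_algebra1) auto
  have "(\<integral>\<omega>. sgn (fst \<omega> - z) * snd \<omega> \<partial>P)
      = (\<integral>\<omega>. sgn (fst \<omega> - z) * real_cond_exp P ?F snd \<omega> \<partial>P)"
    using integrable_sgn(2) by (intro real_cond_exp_intg(2)[symmetric]) auto
  also have "\<dots> = (\<integral>\<omega>. sgn (fst \<omega> - z) * fst \<omega> \<partial>P)"
    using cond_exp by (intro integral_cong_AE) auto
  finally have eq: "(\<integral>\<omega>. sgn (fst \<omega> - z) * snd \<omega> \<partial>P) = (\<integral>\<omega>. sgn (fst \<omega> - z) * fst \<omega> \<partial>P)" .
  have int: "integrable P (\<lambda>\<omega>. sgn (fst \<omega> - z) * z)"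
    by (rule Bochner_Integration.integrable_bound[of P "\<lambda>_. \<bar>z\<bar>"]) (auto simp: abs_mult sgn_if)
  have int': "integrable P (\<lambda>\<omega>. sgn (fst \<omega> - z) * fst \<omega>)"
    by (rule Bochner_Integration.integrable_bound[of P "\<lambda>\<omega>. \<bar>fst \<omega>\<bar>"]) (auto simp: abs_mult sgn_if)
  have "(\<integral>\<omega>. sgn (fst \<omega> - z) * (snd \<omega> - z) \<partial>P) = (\<integral>\<omega>. sgn (fst \<omega> - z) * (fst \<omega> - z) \<partial>P)"
    using int int' integrable_sgn(2) eq by (simp add: right_diff_distrib)
  also have "\<dots> = potential \<mu> z"
    unfolding potential_mu by (intro Bochner_Integration.integral_cong) (auto simp: sgn_if)
  finally show ?thesis .
qed

text \<open>Pointwise, |Y - z| dominates sgn (X - z) (Y - z), and by \<open>expectation_sgn\<close>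
  the difference integrates to \<open>potential \<nu> z - potential \<mu> z\<close>. A nonnegative
  function with integral 0 vanishes almost everywhere.\<close>

lemma potential_eq_iff:
  "potential \<mu> z = potential \<nu> z \<longleftrightarrow> (AE \<omega> in P. \<bar>snd \<omega> - z\<bar> = sgn (fst \<omega> - z) * (snd \<omega> - z))"
  and potential_le: "potential \<mu> z \<le> potential \<nu> z"
proof -
  let ?f = "\<lambda>\<omega>. \<bar>snd \<omega> - z\<bar> - sgn (fst \<omega> - z) * (snd \<omega> - z)"
  have f: "integrable P ?f" "AE \<omega> in P. 0 \<le> ?f \<omega>"
  proof -
    show "integrable P ?f"
      using integrable_sgn(1) by simp
    show "AE \<omega> in P. 0 \<le> ?f \<omega>"
      by (rule AE_I2) (simp add: sgn_if abs_if)
  qed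
  have eq: "(\<integral>\<omega>. ?f \<omega> \<partial>P) = potential \<nu> z - potential \<mu> z"
    using integrable_sgn(1) by (simp add: expectation_sgn potential_nu)
  show "potential \<mu> z \<le> potential \<nu> z"
    using integral_nonneg_AE[OF f(2)] eq by simp
  show "potential \<mu> z = potential \<nu> z \<longleftrightarrow>
      (AE \<omega> in P. \<bar>snd \<omega> - z\<bar> = sgn (fst \<omega> - z) * (snd \<omega> - z))"
    using integral_nonneg_eq_0_iff_AE[OF f] eq by auto
qed

lemma contact_iff: "z \<notin> D \<longleftrightarrow> potential \<mu> z = potential \<nu> z"
  using potential_le[of z] by (auto simp: BJ_domain_def)

text \<open>Case distinction on the sign in \<open>potential_eq_iff\<close>; since
  \<open>sgn 0 = 0\<close>, mass starting at z has to stay there.\<close>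

lemma AE_contact:
  assumes "z \<notin> D"
  shows "AE \<omega> in P. (fst \<omega> < z \<longrightarrow> snd \<omega> \<le> z) \<and> (z < fst \<omega> \<longrightarrow> z \<le> snd \<omega>)
    \<and> (fst \<omega> = z \<longrightarrow> snd \<omega> = z)"
  using assms[unfolded contact_iff not_not potential_eq_iff]
  by eventually_elim (auto simp: sgn_if abs_if split: if_splits)

text \<open>The three rectangles are exactly where the pointwise equality of
  \<open>potential_eq_iff\<close> fails.\<close>

lemma contactI:
  assumes "emeasure P ({..<z} \<times> {z<..}) = 0" "emeasure P ({z<..} \<times> {..<z}) = 0"
    "emeasure P ({z} \<times> - {z}) = 0"
  shows "z \<notin> D"
proof -
  have "AE \<omega> in P. \<omega> \<notin> {..<z} \<times> {z<..}" "AE \<omega> in P. \<omega> \<notin> {z<..} \<times> {..<z}"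
    "AE \<omega> in P. \<omega> \<notin> {z} \<times> - {z}"
    using assms times_in_sets by (auto intro!: AE_not_in simp: null_sets_def)
  then have "AE \<omega> in P. \<bar>snd \<omega> - z\<bar> = sgn (fst \<omega> - z) * (snd \<omega> - z)"
    by eventually_elim (auto simp: sgn_if mem_Times_iff)
  then show ?thesis
    by (simp add: potential_eq_iff contact_iff)
qed

lemma open_D: "open D"
  using open_BJ_domain mu nu .

lemma frontier_component_contact:
  assumes "e \<in> frontier (connected_component_set D x)"
  shows "e \<notin> D"
  using assms frontier_of_connected_component_subset[of D x] frontier_disjoint_eq[of D] open_D by blast

section \<open>The mass that a component sends to its endpoints\<close>

lemma measure_BJ_marginal:
  assumes "open U"
  shows "measure (BJ_marginal P U) {e} = measure P (U \<times> {e})"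
proof -
  have sets: "U \<times> UNIV \<in> sets P" "UNIV \<times> {e} \<in> sets P" "U \<times> {e} \<in> sets P"
    using assms by (auto intro: times_in_sets)
  have "emeasure (BJ_marginal P U) {e} = emeasure (density P (indicator (U \<times> UNIV))) (UNIV \<times> {e})"
    unfolding BJ_marginal_def
    by (subst emeasure_distr) (auto simp: space_P intro!: arg_cong[where f = "emeasure _"])
  also have "\<dots> = (\<integral>\<^sup>+\<omega>. indicator (U \<times> UNIV) \<omega> * indicator (UNIV \<times> {e}) \<omega> \<partial>P)"
    using sets by (subst emeasure_density) (auto simp del: indicator_simps)
  also have "\<dots> = (\<integral>\<^sup>+\<omega>. indicator (U \<times> {e}) \<omega> \<partial>P)"
    by (intro nn_integral_cong) (auto simp: indicator_def)
  also have "\<dots> = emeasure P (U \<times> {e})"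
    using sets by simp
  finally show ?thesis
    by (simp add: measure_def)
qed

text \<open>
  Mass can leave the side \<open>S\<close> of a contact point \<open>e\<close> only into \<open>e\<close>, and, among the points of \<open>S\<close>,
  only those of the adjacent component \<open>U\<close> can reach \<open>e\<close>. So the mass of \<open>e\<close> is a flux that
  depends on the marginals alone.
\<close>

lemma measure_BJ_marginal_frontier:
  assumes x: "x \<in> D" and U: "U = connected_component_set D x" and e: "e \<in> frontier U"
    and S: "S = {..<e} \<or> S = {e<..}" "U \<subseteq> S"
  shows "measure (BJ_marginal P U) {e} = measure \<mu> S - measure \<nu> S"
proof -
  have "x \<in> U"
    unfolding U using x by simp
  then have "U \<noteq> {}"
    by blast
  have "open U" "connected U"
    unfolding U using open_D by (auto intro: open_connected_component)
  have Uu: "U = connected_component_set D u" if "u \<in> U" for u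
    using that unfolding U by (metis connected_component_eq)
  have UD: "U \<subseteq> D"
    unfolding U by (rule connected_component_subset)
  have e_contact: "e \<notin> D"
    using frontier_component_contact e U by blast
  \<comment> \<open>Starting in \<open>S\<close> amounts to one of two disjoint events: moving from
    \<open>U\<close> to \<open>e\<close>, or ending in \<open>S\<close>. Taking measures yields the
    flux formula.\<close>
  have AE: "AE \<omega> in P. \<omega> \<in> S \<times> UNIV \<longleftrightarrow> \<omega> \<in> U \<times> {e} \<union> UNIV \<times> S"
    using \<open>open U\<close> \<open>connected U\<close> \<open>U \<noteq> {}\<close> e
  proof (cases rule: frontier_real_interval)
    case (1 u)
    have Se: "S = {..<e}"
      using S 1 by (auto dest!: subsetD[OF _ 1(2)])
    \<comment> \<open>If this side of \<open>e\<close> has points outside \<open>U\<close>, all of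
      them lie at or beyond a contact point \<open>a\<close> that is separated from \<open>e\<close>
      by \<open>u\<close>, so their mass cannot reach \<open>e\<close>.\<close>
    have "AE \<omega> in P. fst \<omega> < e \<longrightarrow> fst \<omega> \<notin> U \<longrightarrow> snd \<omega> < e"
    proof (cases "{..<e} \<subseteq> U")
      case False
      then obtain w where w: "w < e" "w \<notin> U"
        by auto
      have side: "y < u" if "y < e" "y \<notin> U" for y
        using that 1(4) by (intro not_le_imp_less notI) auto
      then have "w < u"
        using w by blast
      obtain a where a: "a \<notin> D" "a < u" "\<And>x. x < u \<Longrightarrow> x \<notin> U \<Longrightarrow> x \<le> a"
        using left_of_component[OF open_D, of u w] UD 1(2) \<open>w < u\<close> w(2) Uu by auto
      have below: "y \<le> a" if "y < e" "y \<notin> U" for y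
        using that a(3) side by blast
      show ?thesis
        using AE_contact[OF a(1)]
        by eventually_elim (use below a(2) 1(3) in force)
    qed auto
    then show ?thesis
      using AE_contact[OF e_contact]
      by eventually_elim (use 1(1) Se in \<open>auto simp: mem_Times_iff\<close>)
  next
    case (2 u)
    have Se: "S = {e<..}"
      using S 2 by (auto dest!: subsetD[OF _ 2(2)])
    have "AE \<omega> in P. e < fst \<omega> \<longrightarrow> fst \<omega> \<notin> U \<longrightarrow> e < snd \<omega>"
    proof (cases "{e<..} \<subseteq> U")
      case False
      then obtain w where w: "e < w" "w \<notin> U"
        by auto
      have side: "u < y" if "e < y" "y \<notin> U" for y
        using that 2(4) by (intro not_le_imp_less notI) auto
      then have "u < w"
        using w by blast
      obtain a where a: "a \<notin> D" "u < a" "\<And>x. u < x \<Longrightarrow> x \<notin> U \<Longrightarrow> a \<le> x"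
        using right_of_component[OF open_D, of u w] UD 2(2) \<open>u < w\<close> w(2) Uu by auto
      have above: "a \<le> y" if "e < y" "y \<notin> U" for y
        using that a(3) side by blast
      show ?thesis
        using AE_contact[OF a(1)]
        by eventually_elim (use above a(2) 2(3) in force)
    qed auto
    then show ?thesis
      using AE_contact[OF e_contact]
      by eventually_elim (use 2(1) Se in \<open>auto simp: mem_Times_iff\<close>)
  qed
  have S_borel: "S \<in> sets borel"
    using S(1) by auto
  have sets: "S \<times> UNIV \<in> sets P" "UNIV \<times> S \<in> sets P" "U \<times> {e} \<in> sets P"
    using S_borel \<open>open U\<close> by (auto intro: times_in_sets)
  have "measure \<mu> S = measure P (S \<times> UNIV)"
    unfolding distr_fst[symmetric] using S_borel
    by (subst measure_distr) (auto simp: space_P intro!: arg_cong[where f = "measure _"])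
  also have "\<dots> = measure P (U \<times> {e} \<union> UNIV \<times> S)"
    using AE sets by (intro finite_measure_eq_AE) auto
  also have "\<dots> = measure P (U \<times> {e}) + measure P (UNIV \<times> S)"
    using sets S(1) by (intro finite_measure_Union) auto
  also have "measure P (UNIV \<times> S) = measure \<nu> S"
    unfolding distr_snd[symmetric] using S_borel
    by (subst measure_distr) (auto simp: space_P intro!: arg_cong[where f = "measure _"])
  finally show ?thesis
    by (simp add: measure_BJ_marginal \<open>open U\<close>)
qed

end

section \<open>The partition into irreducible components\<close>

text \<open>The final theorem instantiates \<open>P\<close> by \<open>Phat\<close> here.\<close>

locale irreducible_paving = martingale_coupling +
  fixes \<kappa> :: "real \<Rightarrow> real measure"
  assumes kernel: "cond_kernel \<mu> P \<kappa>"
    and I_mem: "\<And>x. x \<in> I_map \<kappa> x"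
    and I_partition: "partition_on UNIV (range (I_map \<kappa>))"
begin

lemma prob_\<kappa>: "prob_space (\<kappa> x)" and sets_\<kappa>: "sets (\<kappa> x) = sets borel"
  and emeasure_P_times: "A \<in> sets borel \<Longrightarrow> B \<in> sets borel \<Longrightarrow>
    emeasure P (A \<times> B) = (\<integral>\<^sup>+x\<in>A. emeasure (\<kappa> x) B \<partial>completion \<mu>)"
  using kernel by (auto simp: cond_kernel_def)

lemma emeasure_P_times_eq_0:
  assumes "A \<in> sets borel" "B \<in> sets borel" "\<And>x. x \<in> A \<Longrightarrow> emeasure (\<kappa> x) B = 0"
  shows "emeasure P (A \<times> B) = 0"
proof -
  \<comment> \<open>The integrand is the zero function everywhere, so measurability does not
    enter.\<close>
  have "(\<lambda>x. emeasure (\<kappa> x) B * indicator A x) = (\<lambda>_. 0)"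
    using assms(3) by (fastforce simp: indicator_def)
  then show ?thesis
    using assms by (simp add: emeasure_P_times)
qed

text \<open>
  The kernel is not known to be measurable for the completion of \<open>\<mu>\<close> without Suslin's theorem, so
  \<open>P (A \<times> B)\<close> is only a lower integral, which might vanish although the integrand is positive.
  Passing to the complement of \<open>B\<close> circumvents this.
\<close>

lemma emeasure_P_times_pos:
  assumes "A \<in> sets borel" "B \<in> sets borel"
    and pos: "\<And>x. x \<in> A \<Longrightarrow> emeasure (\<kappa> x) B \<noteq> 0" and A: "emeasure \<mu> A \<noteq> 0"
  shows "emeasure P (A \<times> B) \<noteq> 0"
proof
  assume 0: "emeasure P (A \<times> B) = 0"
  interpret M: prob_space \<mu> by (rule mu)
  have less: "emeasure (\<kappa> x) (- B) < 1" if "x \<in> A" for x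
  proof -
    interpret K: prob_space "\<kappa> x" by (rule prob_\<kappa>)
    have "space (\<kappa> x) = UNIV"
      using sets_eq_imp_space_eq[OF sets_\<kappa>] by simp
    then have "measure (\<kappa> x) (- B) = 1 - measure (\<kappa> x) B"
      using K.prob_compl[of B] assms(2) by (simp add: sets_\<kappa> Compl_eq_Diff_UNIV)
    moreover have "0 < measure (\<kappa> x) B"
      using pos[OF that] by (simp add: K.emeasure_eq_measure zero_less_measure_iff)
    ultimately show ?thesis
      by (simp add: K.emeasure_eq_measure)
  qed
  \<comment> \<open>All the mass of \<open>A\<close> would go to \<open>- B\<close>, although over
    every point of \<open>A\<close> the kernel gives \<open>- B\<close> less than full mass.\<close>
  have "emeasure \<mu> A = emeasure P (A \<times> UNIV)"
    unfolding distr_fst[symmetric] using assms(1)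
    by (subst emeasure_distr) (auto simp: space_P intro!: arg_cong[where f = "emeasure _"])
  also have "A \<times> UNIV = A \<times> B \<union> A \<times> - B"
    by auto
  also have "emeasure P (A \<times> B \<union> A \<times> - B) = emeasure P (A \<times> B) + emeasure P (A \<times> - B)"
    using assms by (intro plus_emeasure[symmetric] times_in_sets) auto
  also have "\<dots> = (\<integral>\<^sup>+x\<in>A. emeasure (\<kappa> x) (- B) \<partial>completion \<mu>)"
    using 0 assms by (simp add: emeasure_P_times)
  also have "\<dots> < emeasure (completion \<mu>) A"
    using assms less mu(2) by (intro nn_integral_less_emeasure) auto
  also have "\<dots> = emeasure \<mu> A"
    using assms mu(2) by simp
  finally show False
    by simp
qed

section \<open>Blocks of the paving, contact points and endpoint atoms\<close>

lemma I_eq: "y \<in> I_map \<kappa> x \<Longrightarrow> I_map \<kappa> y = I_map \<kappa> x"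
  using I_partition I_mem[of y] by (force simp: partition_on_def disjoint_def)

lemma I_cases:
  obtains "csupp (\<kappa> x) = {x}" "I_map \<kappa> x = {x}" | "open (I_map \<kappa> x)" "I_map \<kappa> x \<noteq> {x}"
  using rel_interior_real_cases[OF convex_csupp I_mem[of x, unfolded I_map_def]]
  unfolding I_map_def by (metis rel_interior_sing)

lemma I_subset_csupp: "I_map \<kappa> x \<subseteq> csupp (\<kappa> x)"
  unfolding I_map_def by (rule rel_interior_subset)

lemma csupp_eq_closure_I: "csupp (\<kappa> x) = closure (I_map \<kappa> x)"
  unfolding I_map_def using convex_closure_rel_interior[OF convex_csupp[of "\<kappa> x"]] closed_csupp[of "\<kappa> x"]
  by (simp add: closure_closed)

lemma I_borel: "I_map \<kappa> x \<in> sets borel"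
  by (cases rule: I_cases[of x]) auto

lemma convex_I: "convex (I_map \<kappa> x)"
  unfolding I_map_def by (intro convex_rel_interior convex_csupp)

lemma contact_if_I_singleton:
  assumes "I_map \<kappa> z = {z}"
  shows "z \<notin> D"
proof -
  have z: "csupp (\<kappa> z) = {z}"
    unfolding csupp_eq_closure_I assms by simp
  have notin: "z \<notin> I_map \<kappa> x" if "x \<noteq> z" for x
    using I_eq[of z x] I_mem[of x] that assms by auto
  \<comment> \<open>An interval containing \<open>x\<close> but not \<open>z\<close> stays on the
    side of \<open>x\<close>; its closure adds at most \<open>z\<close> itself.\<close>
  have left: "csupp (\<kappa> x) \<subseteq> - {z<..}" if "x < z" for x
  proof -
    have "I_map \<kappa> x \<subseteq> {..z}"
    proof
      fix y assume y: "y \<in> I_map \<kappa> x"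
      show "y \<in> {..z}"
      proof (rule ccontr)
        assume "y \<notin> {..z}"
        then have "z \<in> closed_segment x y"
          using that by (simp add: closed_segment_eq_real_ivl)
        then show False
          using closed_segment_subset[OF I_mem y convex_I] notin[of x] that by auto
      qed
    qed
    then have "closure (I_map \<kappa> x) \<subseteq> {..z}"
      by (rule closure_minimal) simp
    then show ?thesis
      unfolding csupp_eq_closure_I by auto
  qed
  have right: "csupp (\<kappa> x) \<subseteq> - {..<z}" if "z < x" for x
  proof -
    have "I_map \<kappa> x \<subseteq> {z..}"
    proof
      fix y assume y: "y \<in> I_map \<kappa> x"
      show "y \<in> {z..}"
      proof (rule ccontr)
        assume "y \<notin> {z..}"
        then have "z \<in> closed_segment y x"
          using that by (simp add: closed_segment_eq_real_ivl)
        then show False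
          using closed_segment_subset[OF y I_mem convex_I] notin[of x] that by auto
      qed
    qed
    then have "closure (I_map \<kappa> x) \<subseteq> {z..}"
      by (rule closure_minimal) simp
    then show ?thesis
      unfolding csupp_eq_closure_I by auto
  qed
  have null: "emeasure (\<kappa> x) B = 0" if "csupp (\<kappa> x) \<subseteq> - B" for x B
    using emeasure_eq_0_if_csupp_subset[OF sets_\<kappa> that] by simp
  show ?thesis
    by (intro contactI emeasure_P_times_eq_0 null) (use left right z in auto)
qed

text \<open>Blocks of points of \<open>D\<close> are open, so \<open>I_map \<kappa> x\<close> and
  the union of the other blocks would otherwise disconnect the component.\<close>

lemma component_subset_I:
  assumes "x \<in> D"
  shows "connected_component_set D x \<subseteq> I_map \<kappa> x"
proof -
  let ?U = "connected_component_set D x" and ?W = "\<Union>z \<in> D - I_map \<kappa> x. I_map \<kappa> z"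
  have opn: "open (I_map \<kappa> z)" if "z \<in> D" for z
    using contact_if_I_singleton[of z] that by (cases rule: I_cases[of z]) auto
  have disj: "I_map \<kappa> x \<inter> ?W = {}"
    using I_eq I_mem by blast
  have cover: "?U \<subseteq> I_map \<kappa> x \<union> ?W"
    using connected_component_subset[of D x] I_mem by blast
  have "I_map \<kappa> x \<inter> ?U = {} \<or> ?W \<inter> ?U = {}"
    using disj cover opn assms by (intro connectedD) auto
  moreover have "x \<in> I_map \<kappa> x \<inter> ?U"
    using I_mem assms by simp
  ultimately show ?thesis
    using cover by blast
qed

text \<open>At a contact point z of the block, mass from the left part, the right part and z itself
  stays in \<open>{..z}\<close>, \<open>{z..}\<close> and \<open>{z}\<close> respectively. No kernel
  over the block is carried by any of these sets, as each support spans the whole open block around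
  z. So all three parts are null.\<close>

lemma I_subset_D:
  assumes opn: "open (I_map \<kappa> x)" and pos: "emeasure \<mu> (I_map \<kappa> x) \<noteq> 0"
  shows "I_map \<kappa> x \<subseteq> D"
proof
  fix z assume z: "z \<in> I_map \<kappa> x"
  have ne: "\<not> I_map \<kappa> x \<subseteq> C" if "C \<in> {{..z}, {z..}, {z}}" for C
  proof
    assume "I_map \<kappa> x \<subseteq> C"
    then have "z \<in> interior C"
      using opn z interior_maximal by blast
    then show False
      using that by auto
  qed
  have kpos: "emeasure (\<kappa> y) (- C) \<noteq> 0" if "y \<in> I_map \<kappa> x" "C \<in> {{..z}, {z..}, {z}}" for y C
  proof
    assume "emeasure (\<kappa> y) (- C) = 0"
    then have "csupp (\<kappa> y) \<subseteq> C"
      using that(2) by (intro csupp_subset) auto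
    then show False
      using ne[OF that(2)] I_subset_csupp[of y] I_eq[OF that(1)] by auto
  qed
  show "z \<in> D"
  proof (rule ccontr)
    assume "z \<notin> D"
    note AE = AE_contact[OF this]
    have null: "emeasure \<mu> A = 0"
      if "A \<in> sets borel" "A \<subseteq> I_map \<kappa> x" "C \<in> {{..z}, {z..}, {z}}"
        "AE \<omega> in P. \<omega> \<notin> A \<times> - C" for A C
    proof (rule ccontr)
      assume "emeasure \<mu> A \<noteq> 0"
      moreover have C: "- C \<in> sets borel"
        using that(3) by auto
      ultimately have "emeasure P (A \<times> - C) \<noteq> 0"
        using that kpos by (intro emeasure_P_times_pos) blast+
      moreover have "A \<times> - C \<in> null_sets P"
        using that(4) times_in_sets[OF that(1) C] by (simp add: AE_iff_null_sets)
      ultimately show False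
        by (simp add: null_sets_def)
    qed
    have "emeasure \<mu> (I_map \<kappa> x \<inter> {..<z}) = 0"
    proof (rule null)
      show "AE \<omega> in P. \<omega> \<notin> (I_map \<kappa> x \<inter> {..<z}) \<times> - {..z}"
        using AE by eventually_elim auto
    qed (use I_borel in auto)
    moreover have "emeasure \<mu> (I_map \<kappa> x \<inter> {z<..}) = 0"
    proof (rule null)
      show "AE \<omega> in P. \<omega> \<notin> (I_map \<kappa> x \<inter> {z<..}) \<times> - {z..}"
        using AE by eventually_elim auto
    qed (use I_borel in auto)
    moreover have "emeasure \<mu> {z} = 0"
    proof (rule null)
      show "AE \<omega> in P. \<omega> \<notin> {z} \<times> - {z}"
        using AE by eventually_elim auto
    qed (use z in auto)
    ultimately have "I_map \<kappa> x \<inter> {..<z} \<in> null_sets \<mu>" "I_map \<kappa> x \<inter> {z<..} \<in> null_sets \<mu>"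
      "{z} \<in> null_sets \<mu>"
      using I_borel mu(2) by auto
    then have "I_map \<kappa> x \<inter> {..<z} \<union> I_map \<kappa> x \<inter> {z<..} \<union> {z} \<in> null_sets \<mu>"
      by (intro null_sets.Un)
    moreover have "I_map \<kappa> x = I_map \<kappa> x \<inter> {..<z} \<union> I_map \<kappa> x \<inter> {z<..} \<union> {z}"
      using z by auto
    ultimately show False
      using pos by (metis null_setsD1)
  qed
qed

text \<open>The exceptional set is the union of the null open blocks, which are countably many since
  they are disjoint. Positivity of the block is kept for the study of its endpoints.\<close>

lemma AE_I_cases:
  "AE x in \<mu>. I_map \<kappa> x = {x} \<and> x \<notin> D \<or>
     x \<in> D \<and> I_map \<kappa> x = connected_component_set D x \<and> emeasure \<mu> (I_map \<kappa> x) \<noteq> 0"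
proof -
  let ?F = "{S \<in> range (I_map \<kappa>). open S}"
  let ?N = "{S \<in> ?F. emeasure \<mu> S = 0}"
  have "pairwise disjnt ?F"
    using I_partition by (auto simp: partition_on_def disjoint_def pairwise_def disjnt_def)
  then have "countable ?F"
    by (intro countable_disjoint_open_subsets) auto
  then have "countable ?N"
    by (rule countable_subset[rotated]) auto
  then have "(\<Union>S\<in>?N. S) \<in> null_sets \<mu>"
    using mu(2) by (intro null_sets_UN') (auto simp: null_sets_def)
  then have "AE x in \<mu>. x \<notin> (\<Union>S\<in>?N. S)"
    by (rule AE_not_in)
  then show ?thesis
  proof eventually_elim
    case (elim x)
    show ?case
    proof (cases rule: I_cases[of x])
      case 1
      then show ?thesis
        using contact_if_I_singleton by auto
    next
      case 2
      then have pos: "emeasure \<mu> (I_map \<kappa> x) \<noteq> 0"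
        using elim I_mem[of x] by auto
      then have sub: "I_map \<kappa> x \<subseteq> D"
        using I_subset_D 2 by blast
      then have "I_map \<kappa> x \<subseteq> connected_component_set D x"
        using I_mem convex_I by (intro connected_component_maximal convex_connected)
      then show ?thesis
        using pos sub I_mem[of x] component_subset_I[of x] by auto
    qed
  qed
qed

text \<open>A cycle: membership in \<open>J_upper\<close> gives positive mass at \<open>e\<close>,
  this gives membership in \<open>J_lower\<close>, and \<open>incl\<close> closes the cycle.\<close>

lemma frontier_atom_iff:
  assumes x: "x \<in> D" and I: "I_map \<kappa> x = connected_component_set D x"
    and pos: "emeasure \<mu> (I_map \<kappa> x) \<noteq> 0" and e: "e \<in> frontier (I_map \<kappa> x)"
    and incl: "J_lower \<nu> \<kappa> x \<subseteq> J_upper \<kappa> x"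
    and lower: "\<And>y. y \<in> I_map \<kappa> x \<Longrightarrow> J_lower \<nu> \<kappa> y = J_lower \<nu> \<kappa> x"
    and upper: "\<And>y. y \<in> I_map \<kappa> x \<Longrightarrow> J_upper \<kappa> y = J_upper \<kappa> x"
  shows "e \<in> J_lower \<nu> \<kappa> x \<longleftrightarrow> 0 < measure (BJ_marginal P (I_map \<kappa> x)) {e}"
    and "e \<in> J_upper \<kappa> x \<longleftrightarrow> 0 < measure (BJ_marginal P (I_map \<kappa> x)) {e}"
proof -
  let ?I = "I_map \<kappa> x"
  have opn: "open ?I"
    unfolding I using open_D by (rule open_connected_component)
  have e_notin: "e \<notin> ?I"
    using e opn frontier_disjoint_eq by blast
  have marginal: "measure (BJ_marginal P ?I) {e} = measure P (?I \<times> {e})"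
    using opn by (rule measure_BJ_marginal)
  \<comment> \<open>Constancy of \<open>J_upper\<close> makes every kernel over the block charge
    \<open>e\<close>, and the block has positive mass.\<close>
  have 1: "0 < measure P (?I \<times> {e})" if "e \<in> J_upper \<kappa> x"
  proof -
    have "emeasure (\<kappa> y) {e} \<noteq> 0" if y: "y \<in> ?I" for y
    proof -
      have "e \<in> csupp (mrestr (\<kappa> y) (rel_frontier ?I))"
        using \<open>e \<in> J_upper \<kappa> x\<close> upper[OF y] e_notin I_eq[OF y] by (auto simp: J_upper_def)
      also have "rel_frontier ?I = frontier ?I"
        using opn by (simp add: rel_frontier_def frontier_def rel_interior_open interior_open)
      finally show ?thesis
        using sets_\<kappa> opn e y convex_connected[OF convex_I, of x]
        by (intro emeasure_pos_if_endpoint_in_csupp) auto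
    qed
    then have "emeasure P (?I \<times> {e}) \<noteq> 0"
      using pos I_borel by (intro emeasure_P_times_pos) auto
    then show ?thesis
      by (simp add: emeasure_eq_measure zero_less_measure_iff)
  qed
  \<comment> \<open>Positive mass provides one \<open>y\<close> whose kernel charges
    \<open>e\<close>; constancy of \<open>J_lower\<close> carries this over to
    \<open>x\<close>.\<close>
  have 2: "e \<in> J_lower \<nu> \<kappa> x" if p: "0 < measure P (?I \<times> {e})"
  proof -
    have "measure P (?I \<times> {e}) \<le> measure P (UNIV \<times> {e})"
      by (intro finite_measure_mono times_in_sets) auto
    also have "\<dots> = measure \<nu> {e}"
      unfolding distr_snd[symmetric]
      by (subst measure_distr) (auto simp: space_P intro!: arg_cong[where f = "measure _"])
    finally have nu_e: "0 < measure \<nu> {e}"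
      using p by simp
    have "emeasure P (?I \<times> {e}) \<noteq> 0"
      using p by (simp add: emeasure_eq_measure)
    then obtain y where y: "y \<in> ?I" "emeasure (\<kappa> y) {e} \<noteq> 0"
      using emeasure_P_times_eq_0[of ?I "{e}"] I_borel by auto
    interpret K: prob_space "\<kappa> y" by (rule prob_\<kappa>)
    have "0 < measure (\<kappa> y) {e}"
      using y(2) by (simp add: K.emeasure_eq_measure zero_less_measure_iff)
    then have "e \<in> J_lower \<nu> \<kappa> y"
      using nu_e by (simp add: J_lower_def)
    then show ?thesis
      using lower[OF y(1)] by simp
  qed
  show "e \<in> J_lower \<nu> \<kappa> x \<longleftrightarrow> 0 < measure (BJ_marginal P ?I) {e}"
    "e \<in> J_upper \<kappa> x \<longleftrightarrow> 0 < measure (BJ_marginal P ?I) {e}"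
    using 1 2 incl marginal by auto
qed

end

text \<open>The flux formula has the same right-hand side for both couplings. This links the paving
  of \<open>Phat\<close> with a \<open>J_BJ\<close> formed from another coupling.\<close>

lemma measure_BJ_marginal_eq:
  assumes "martingale_coupling \<mu> \<nu> P" "martingale_coupling \<mu> \<nu> Q"
    and x: "x \<in> BJ_domain \<mu> \<nu>" and U: "U = connected_component_set (BJ_domain \<mu> \<nu>) x"
    and e: "e \<in> frontier U"
  shows "measure (BJ_marginal P U) {e} = measure (BJ_marginal Q U) {e}"
proof -
  interpret P: martingale_coupling \<mu> \<nu> P by fact
  interpret Q: martingale_coupling \<mu> \<nu> Q by fact
  have U': "open U" "connected U"
    unfolding U using P.open_D by (auto intro: open_connected_component)
  have "U \<noteq> {}"
    using x connected_component_refl_eq[of _ x] unfolding U by blast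
  with U' obtain S where "S = {..<e} \<or> S = {e<..}" "U \<subseteq> S"
    using e frontier_real_interval[of U e] by metis
  then show ?thesis
    using P.measure_BJ_marginal_frontier[OF x U e] Q.measure_BJ_marginal_frontier[OF x U e] by simp
qed

theorem proposition2p6:
  fixes \<mu> \<nu> :: "real measure"
    and Phat P :: "(real \<times> real) measure"
    and \<kappa> :: "real \<Rightarrow> real measure"
  assumes mu: "prob_space \<mu>" "sets \<mu> = sets borel" "integrable \<mu> (\<lambda>x. x)"
    and nu: "prob_space \<nu>" "sets \<nu> = sets borel" "integrable \<nu> (\<lambda>x. x)"
    and order: "convex_order \<mu> \<nu>"
    and Phat: "Phat \<in> martingale_couplings \<mu> \<nu>"
    and kernel: "cond_kernel \<mu> Phat \<kappa>"
    and a_csupp: "\<And>Q q. Q \<in> martingale_couplings \<mu> \<nu> \<Longrightarrow> cond_kernel \<mu> Q q \<Longrightarrow>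
          AE x in \<mu>. csupp (q x) \<subseteq> csupp (\<kappa> x)"
    and a_boundary: "\<And>Q q. Q \<in> martingale_couplings \<mu> \<nu> \<Longrightarrow> cond_kernel \<mu> Q q \<Longrightarrow>
          AE x in \<mu>. msupp (mrestr (q x) (rel_frontier (I_map \<kappa> x)))
                   \<subseteq> csupp (mrestr (\<kappa> x) (rel_frontier (I_map \<kappa> x)))"
    and a_atoms: "\<And>Q q y. Q \<in> martingale_couplings \<mu> \<nu> \<Longrightarrow> cond_kernel \<mu> Q q \<Longrightarrow>
          measure (completion \<mu>) {x. measure (q x) {y} > 0}
            \<le> measure (completion \<mu>) {x. measure (\<kappa> x) {y} > 0}"
    and b_measurable: "analytically_measurable_setmap (\<lambda>x. csupp (\<kappa> x))"
    and b_mem: "\<And>x. x \<in> I_map \<kappa> x"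
    and b_partition: "partition_on UNIV (range (I_map \<kappa>))"
    and c_convex: "\<And>x. convex (J_upper \<kappa> x)"
    and c_incl: "\<And>x. I_map \<kappa> x \<subseteq> J_lower \<nu> \<kappa> x"
                "\<And>x. J_lower \<nu> \<kappa> x \<subseteq> J_upper \<kappa> x"
                "\<And>x. J_upper \<kappa> x \<subseteq> closure (I_map \<kappa> x)"
    and c_const: "\<And>x x'. x' \<in> I_map \<kappa> x \<Longrightarrow> J_lower \<nu> \<kappa> x' = J_lower \<nu> \<kappa> x"
                 "\<And>x x'. x' \<in> I_map \<kappa> x \<Longrightarrow> J_upper \<kappa> x' = J_upper \<kappa> x"
    and P: "P \<in> martingale_couplings \<mu> \<nu>"
  shows "AE x in \<mu>. I_map \<kappa> x = I_BJ \<mu> \<nu> x \<and>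
                    J_upper \<kappa> x = J_BJ \<mu> \<nu> P x \<and> J_lower \<nu> \<kappa> x = J_BJ \<mu> \<nu> P x"
proof -
  interpret K: irreducible_paving \<mu> \<nu> Phat \<kappa>
    by (intro irreducible_paving.intro martingale_coupling.intro irreducible_paving_axioms.intro
        mu nu Phat kernel b_mem b_partition)
  interpret P: martingale_coupling \<mu> \<nu> P
    by (intro martingale_coupling.intro mu nu P)
  show ?thesis
    using K.AE_I_cases
  proof eventually_elim
    case (elim x)
    let ?D = "BJ_domain \<mu> \<nu>"
    note between = c_incl(1)[of x] c_incl(2)[of x] c_incl(3)[of x]
    from elim show ?case
    proof (elim disjE conjE)
      assume I: "I_map \<kappa> x = {x}" and x: "x \<notin> ?D"
      \<comment> \<open>Both maps lie between the block and its closure, which coincide for a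
        singleton.\<close>
      have "J_lower \<nu> \<kappa> x = {x}" "J_upper \<kappa> x = {x}"
        using between unfolding I by auto
      then show ?thesis
        using I x by (simp add: I_BJ_def J_BJ_def)
    next
      assume x: "x \<in> ?D" and I: "I_map \<kappa> x = connected_component_set ?D x"
        and pos: "emeasure \<mu> (I_map \<kappa> x) \<noteq> 0"
      let ?U = "I_map \<kappa> x"
      have J_BJ: "J_BJ \<mu> \<nu> P x = ?U \<union> {e \<in> frontier ?U. 0 < measure (BJ_marginal P ?U) {e}}"
        using x by (simp add: J_BJ_def I Let_def)
      have cl: "closure ?U = ?U \<union> frontier ?U"
        by (rule closure_Un_frontier)
      have iff: "e \<in> J_lower \<nu> \<kappa> x \<longleftrightarrow> 0 < measure (BJ_marginal P ?U) {e}"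
        "e \<in> J_upper \<kappa> x \<longleftrightarrow> 0 < measure (BJ_marginal P ?U) {e}" if e: "e \<in> frontier ?U" for e
        using K.frontier_atom_iff[OF x I pos e between(2) c_const]
          measure_BJ_marginal_eq[OF K.martingale_coupling_axioms P.martingale_coupling_axioms x I e]
        by simp_all
      \<comment> \<open>Between the block and its closure only frontier points are undecided, and
        \<open>iff\<close> settles them.\<close>
      have "J_lower \<nu> \<kappa> x = J_BJ \<mu> \<nu> P x" "J_upper \<kappa> x = J_BJ \<mu> \<nu> P x"
        unfolding J_BJ using between cl iff by blast+
      then show ?thesis
        using x I by (simp add: I_BJ_def)
    qed
  qed
qed

end
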